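(* Each of the following sets is FSM non-uniformly infinite (i.e. none of them contains an infinite uniformly supported subset): (1) the set $A$ of atoms; (2) $\wp_{fs}(A)$; (3) $T_{fin}(A)$, the set of all finite injective tuples of atoms; (4) the set $\wp_{fs}(A)^A_{fs}$ of all finitely supported functions $f:A\to\wp_{fs}(A)$; (5) the set $A^A_{fs}$ of all finitely supported functions $f:A\to A$; (6) for each $n\in\mathbb N$, the set of all finitely supported functions $f:A\to A^n$, where $A^n$ is the $n$-fold Cartesian product; (7) the set of all finitely supported functions $f:A\to T_{fin}(A)$; (8) $\wp_{fin}(A)$, $\wp_{cofin}(A)$, $\wp_{fin}(\wp_{fs}(A))$ and $\wp_{fin}(A^A_{fs})$; (9) every iterated finite powerset of the forms $\wp_{fin}(\cdots\wp_{fin}(A))$, $\wp_{fin}(\cdots\wp_{fin}(A^A_{fs}))$ and $\wp_{fin}(\cdots\wp_{fin}(\wp_{fs}(A)))$; (10) every finite Cartesian product whose factors are each among $A$, $\wp_{fin}(A)$, $\wp_{cofin}(A)$, $\wp_{fs}(A)$, $A^A_{fs}$; (11) the disjoint unions $A+A^A_{fs}$, $A+\wp_{fs}(A)$, $\wp_{fs}(A)+A^A_{fs}$, $A+\wp_{fs}(A)+A^A_{fs}$, and every finite disjoint union whose summands are each among $A$, $A^A_{fs}$, $\wp_{fs}(A)$.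
   Context: Fix an infinite set $A$ of atoms. $S_A$ is the group of bijections of $A$ that are compositions of finitely many transpositions; it acts on $A$ by $\pi\cdot a=\pi(a)$. An $S_A$-set is a set with a group action $\cdot$ of $S_A$. For $S\subseteq A$, $Fix(S)=\{\pi\in S_A:\pi(a)=a\ \forall a\in S\}$; $S$ supports $x$ if $\pi\cdot x=x$ for all $\pi\in Fix(S)$; the least finite supporting set of $x$ is $supp(x)$. An invariant set is an $S_A$-set all of whose elements have finite supporting sets. Powersets carry $\pi\star Z=\{\pi\cdot z:z\in Z\}$; $\wp_{fs}(Y)$ is the set of subsets of $Y$ finitely supported under $\star$; $\wp_{fin}(Y)$ and $\wp_{cofin}(Y)$ are the sets of finite and cofinite subsets of $Y$. Cartesian products and tuple sets carry the componentwise action; disjoint unions $X+Y=\{(0,x)\}\cup\{(1,y)\}$ carry $\pi\cdot(i,z)=(i,\pi\cdot z)$. For invariant sets $X,Y$, functions $X\to Y$ carry the action $(\pi\widetilde\star f)(x)=\pi\cdot f(\pi^{-1}\cdot x)$, and $Y^X_{fs}$ is the invariant set of functions $X\to Y$ finitely supported under this action (equivalently, whose graph is a finitely supported subset of $X\times Y$). $T_{fin}(A)$ is the set of finite tuples of pairwise distinct atoms. A set is uniformly supported if one finite $S\subseteq A$ supports all its elements. A finitely supported subset of an invariant set is FSM uniformly infinite if it contains an infinite uniformly supported subset, FSM non-uniformly infinite otherwise. *)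

theory Defs
  imports
    "HOL-Algebra.Group_Action"
    "HOL-Combinatorics.Permutations"
    "HOL-Library.FSet"
begin

text \<open>The atoms are the elements of a type \<open>'a\<close>.
  The library predicate \<^const>\<open>permutation\<close> says that a function is a composition of
  finitely many transpositions.\<close>

definition atom_perms :: "('a \<Rightarrow> 'a) monoid" where
  "atom_perms = \<lparr>carrier = {\<pi>. permutation \<pi>}, monoid.mult = (\<circ>), one = id\<rparr>"

record ('a, 'x) sa_set = "'x partial_object" +
  act :: "('a \<Rightarrow> 'a) \<Rightarrow> 'x \<Rightarrow> 'x"

text \<open>The target \<^term>\<open>BijGroup (carrier X)\<close> of a \<^const>\<open>group_action\<close> consists of
  extensional functions, hence the restriction.\<close>

definition is_sa_set :: "('a, 'x) sa_set \<Rightarrow> bool" where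
  "is_sa_set X \<longleftrightarrow>
     group_action atom_perms (carrier X) (\<lambda>\<pi>. restrict (act X \<pi>) (carrier X))"

definition Fix :: "'a set \<Rightarrow> ('a \<Rightarrow> 'a) set" where
  "Fix S = {\<pi> \<in> carrier atom_perms. \<forall>a\<in>S. \<pi> a = a}"

definition supports :: "('a, 'x) sa_set \<Rightarrow> 'a set \<Rightarrow> 'x \<Rightarrow> bool" where
  "supports X S x \<longleftrightarrow> (\<forall>\<pi>\<in>Fix S. act X \<pi> x = x)"

definition finitely_supported :: "('a, 'x) sa_set \<Rightarrow> 'x \<Rightarrow> bool" where
  "finitely_supported X x \<longleftrightarrow> (\<exists>S. finite S \<and> supports X S x)"

definition uniformly_supported :: "('a, 'x) sa_set \<Rightarrow> 'x set \<Rightarrow> bool" where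
  "uniformly_supported X Z \<longleftrightarrow> (\<exists>S. finite S \<and> (\<forall>x\<in>Z. supports X S x))"

definition invariant_set :: "('a, 'x) sa_set \<Rightarrow> bool" where
  "invariant_set X \<longleftrightarrow> is_sa_set X \<and> (\<forall>x\<in>carrier X. finitely_supported X x)"

definition fs_part :: "('a, 'x) sa_set \<Rightarrow> ('a, 'x) sa_set" where
  "fs_part X = X\<lparr>carrier := {x \<in> carrier X. finitely_supported X x}\<rparr>"


definition atoms :: "('a, 'a) sa_set" where
  "atoms = \<lparr>carrier = UNIV, act = (\<lambda>\<pi> a. \<pi> a)\<rparr>"

definition pow_set :: "('a, 'x) sa_set \<Rightarrow> ('a, 'x set) sa_set" where
  "pow_set X = \<lparr>carrier = Pow (carrier X), act = (\<lambda>\<pi> Z. act X \<pi> ` Z)\<rparr>"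

definition pow_fs :: "('a, 'x) sa_set \<Rightarrow> ('a, 'x set) sa_set" where
  "pow_fs X = fs_part (pow_set X)"

definition pow_fin :: "('a, 'x) sa_set \<Rightarrow> ('a, 'x set) sa_set" where
  "pow_fin X = (pow_set X)\<lparr>carrier := Fpow (carrier X)\<rparr>"

definition pow_cofin :: "('a, 'x) sa_set \<Rightarrow> ('a, 'x set) sa_set" where
  "pow_cofin X = (pow_set X)\<lparr>carrier := {Z \<in> Pow (carrier X). finite (carrier X - Z)}\<rparr>"

definition funs :: "('a, 'x) sa_set \<Rightarrow> ('a, 'y) sa_set \<Rightarrow> ('a, 'x \<Rightarrow> 'y) sa_set" where
  "funs X Y =
     \<lparr>carrier = carrier X \<rightarrow>\<^sub>E carrier Y,
      act = (\<lambda>\<pi> f. \<lambda>x\<in>carrier X. act Y \<pi> (f (act X (inv_into UNIV \<pi>) x)))\<rparr>"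

definition fs_funs :: "('a, 'x) sa_set \<Rightarrow> ('a, 'y) sa_set \<Rightarrow> ('a, 'x \<Rightarrow> 'y) sa_set" where
  "fs_funs X Y = fs_part (funs X Y)"

definition inj_tuples :: "('a, 'x) sa_set \<Rightarrow> ('a, 'x list) sa_set" where
  "inj_tuples X =
     \<lparr>carrier = {xs. distinct xs \<and> set xs \<subseteq> carrier X}, act = (\<lambda>\<pi>. map (act X \<pi>))\<rparr>"

definition cart_prod :: "('a, 'x) sa_set list \<Rightarrow> ('a, 'x list) sa_set" where
  "cart_prod Xs =
     \<lparr>carrier = listset (map carrier Xs), act = (\<lambda>\<pi>. map2 (\<lambda>X. act X \<pi>) Xs)\<rparr>"

definition disj_union :: "('a, 'x) sa_set \<Rightarrow> ('a, 'y) sa_set \<Rightarrow> ('a, 'x + 'y) sa_set"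
    (infixr "\<uplus>\<^sub>s" 65) where
  "X \<uplus>\<^sub>s Y =
     \<lparr>carrier = carrier X <+> carrier Y, act = (\<lambda>\<pi>. map_sum (act X \<pi>) (act Y \<pi>))\<rparr>"

definition disj_unions :: "('a, 'x) sa_set list \<Rightarrow> ('a, nat \<times> 'x) sa_set" where
  "disj_unions Xs =
     \<lparr>carrier = (SIGMA i:{..<length Xs}. carrier (Xs ! i)),
      act = (\<lambda>\<pi> (i, x). (i, act (Xs ! i) \<pi> x))\<rparr>"


text \<open>Iterated finite powersets of arbitrary depth live in different types, so they are
  realised inside the type of hereditarily finite sets over \<open>'x\<close>: the elements of
  \<open>iter_pow_fin (Suc n) X\<close> are exactly the finite sets of elements of \<open>iter_pow_fin n X\<close>,
  with \<open>HSet\<close> packing a finite set into the type.  The map function of the type acts by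
  \<open>map_hf f (HSet Z) = HSet (map_hf f |`| Z)\<close>, which is the powerset action.\<close>

datatype 'x hf = Base 'x | HSet "'x hf fset"

primrec iter_pow_fin_carrier :: "nat \<Rightarrow> 'x set \<Rightarrow> 'x hf set" where
  "iter_pow_fin_carrier 0 U = Base ` U"
| "iter_pow_fin_carrier (Suc n) U = HSet ` {Z. fset Z \<subseteq> iter_pow_fin_carrier n U}"

definition iter_pow_fin :: "nat \<Rightarrow> ('a, 'x) sa_set \<Rightarrow> ('a, 'x hf) sa_set" where
  "iter_pow_fin n X =
     \<lparr>carrier = iter_pow_fin_carrier n (carrier X), act = (\<lambda>\<pi>. map_hf (act X \<pi>))\<rparr>"


text \<open>To form products and disjoint unions of arbitrarily many sets taken among sets of
  atoms, of sets of atoms and of functions on atoms, these are embedded in one common type.\<close>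

datatype 'a obj = Atom 'a | Subset "'a set" | AtomFun "'a \<Rightarrow> 'a"

primrec obj_act :: "('a \<Rightarrow> 'a) \<Rightarrow> 'a obj \<Rightarrow> 'a obj" where
  "obj_act \<pi> (Atom a) = Atom (act atoms \<pi> a)"
| "obj_act \<pi> (Subset Z) = Subset (act (pow_set atoms) \<pi> Z)"
| "obj_act \<pi> (AtomFun f) = AtomFun (act (funs atoms atoms) \<pi> f)"

definition as_obj :: "('x \<Rightarrow> 'a obj) \<Rightarrow> ('a, 'x) sa_set \<Rightarrow> ('a, 'a obj) sa_set" where
  "as_obj c X = \<lparr>carrier = c ` carrier X, act = obj_act\<rparr>"


text \<open>Both notions are predicates of a finitely supported subset \<open>Z\<close> of an invariant set \<open>X\<close>;
  that \<open>Z\<close> and \<open>X\<close> are of this kind is made part of them.\<close>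

definition FSM_uniformly_infinite :: "('a, 'x) sa_set \<Rightarrow> 'x set \<Rightarrow> bool" where
  "FSM_uniformly_infinite X Z \<longleftrightarrow>
     invariant_set X \<and> Z \<in> carrier (pow_fs X) \<and>
     (\<exists>W\<subseteq>Z. infinite W \<and> uniformly_supported X W)"

definition FSM_non_uniformly_infinite_in :: "('a, 'x) sa_set \<Rightarrow> 'x set \<Rightarrow> bool" where
  "FSM_non_uniformly_infinite_in X Z \<longleftrightarrow>
     invariant_set X \<and> Z \<in> carrier (pow_fs X) \<and> \<not> FSM_uniformly_infinite X Z"

definition FSM_non_uniformly_infinite :: "('a, 'x) sa_set \<Rightarrow> bool" where
  "FSM_non_uniformly_infinite X \<longleftrightarrow> FSM_non_uniformly_infinite_in X (carrier X)"

end

theory Submission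
  imports Defs
begin

text \<open>An invariant set contains no infinite uniformly supported subset iff for every finite \<open>S\<close> it
  has only finitely many elements supported by \<open>S\<close>. This condition passes to function sets
  \<open>Y\<^sup>A\<close>, because \<open>f\<close> supported by \<open>S\<close> is determined by its values on \<open>S \<union> {b}\<close> for a single
  \<open>b \<notin> S\<close>, and these values are supported by \<open>S \<union> {b}\<close>. It passes to finite powersets, because
  the elements of a finite set supported by \<open>S\<close> are themselves supported by \<open>S\<close>. Products,
  injective tuples and disjoint unions are immediate.\<close>

section \<open>Actions and supports\<close>

lemma supports_iff:
  "supports X S x \<longleftrightarrow> (\<forall>\<pi>. permutation \<pi> \<longrightarrow> (\<forall>a\<in>S. \<pi> a = a) \<longrightarrow> act X \<pi> x = x)"
  by (auto simp: supports_def Fix_def atom_perms_def)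

lemma permutation_inv_comp:
  assumes "permutation \<pi>"
  shows "inv_into UNIV \<pi> \<circ> \<pi> = id" "\<pi> \<circ> inv_into UNIV \<pi> = id"
  using permutation_bijective[OF assms] by (simp_all add: bij_is_inj bij_is_surj surj_iff[symmetric])

lemma group_atom_perms: "group atom_perms"
proof (rule groupI)
  fix \<pi> :: "'a \<Rightarrow> 'a"
  assume "\<pi> \<in> carrier atom_perms"
  then show "\<exists>\<sigma>\<in>carrier atom_perms. \<sigma> \<otimes>\<^bsub>atom_perms\<^esub> \<pi> = \<one>\<^bsub>atom_perms\<^esub>"
    by (auto simp: atom_perms_def permutation_inverse permutation_inv_comp(1) intro!: exI[of _ "inv_into UNIV \<pi>"])
qed (auto simp: atom_perms_def permutation_compose comp_assoc)

text \<open>\<open>group_action\<close> asks for a homomorphism into the group of extensional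
  bijections of the carrier. Bijectivity follows from closure and the two action laws, because the
  inverse permutation acts as a two-sided inverse. All later verifications of
  \<open>is_sa_set\<close> rest on this elementary form.\<close>

lemma is_sa_set_iff:
  fixes X :: "('a, 'x) sa_set"
  shows "is_sa_set X \<longleftrightarrow>
     (\<forall>\<pi>. permutation \<pi> \<longrightarrow> (\<forall>x\<in>carrier X. act X \<pi> x \<in> carrier X)) \<and>
     (\<forall>x\<in>carrier X. act X id x = x) \<and>
     (\<forall>\<pi> \<sigma>. permutation \<pi> \<longrightarrow> permutation \<sigma> \<longrightarrow>
        (\<forall>x\<in>carrier X. act X (\<pi> \<circ> \<sigma>) x = act X \<pi> (act X \<sigma> x)))"
  (is "_ \<longleftrightarrow> ?closed \<and> ?id \<and> ?comp")
proof
  assume "is_sa_set X"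
  then interpret group_action atom_perms "carrier X" "\<lambda>\<pi>. restrict (act X \<pi>) (carrier X)"
    by (simp add: is_sa_set_def)
  have closed: ?closed
    using element_image by (fastforce simp: atom_perms_def)
  moreover have ?id
    using id_eq_one by (metis atom_perms_def monoid.select_convs(2) restrict_apply')
  moreover have ?comp
  proof (intro allI impI ballI)
    fix \<pi> \<sigma> :: "'a \<Rightarrow> 'a" and x
    assume "permutation \<pi>" "permutation \<sigma>" and x: "x \<in> carrier X"
    then have "restrict (act X (\<pi> \<circ> \<sigma>)) (carrier X) x =
        restrict (act X \<pi>) (carrier X) (restrict (act X \<sigma>) (carrier X) x)"
      using composition_rule[of x \<pi> \<sigma>] by (simp add: atom_perms_def)
    then show "act X (\<pi> \<circ> \<sigma>) x = act X \<pi> (act X \<sigma> x)"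
      using x closed \<open>permutation \<sigma>\<close> by simp
  qed
  ultimately show "?closed \<and> ?id \<and> ?comp" by blast
next
  assume *: "?closed \<and> ?id \<and> ?comp"
  have bij: "restrict (act X \<pi>) (carrier X) \<in> Bij (carrier X)" if "permutation \<pi>" for \<pi>
  proof -
    have inv: "act X (inv_into UNIV \<pi>) (act X \<pi> x) = x" "act X \<pi> (act X (inv_into UNIV \<pi>) x) = x"
      if "x \<in> carrier X" for x
      using * that \<open>permutation \<pi>\<close> by (metis permutation_inverse permutation_inv_comp)+
    have "bij_betw (act X \<pi>) (carrier X) (carrier X)"
      using * that by (intro bij_betwI[where g = "act X (inv_into UNIV \<pi>)"])
        (auto simp: inv permutation_inverse)
    then show ?thesis
      by (simp add: Bij_def)
  qed
  show "is_sa_set X"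
    unfolding is_sa_set_def
  proof (intro group_action.intro group_hom.intro group_hom_axioms.intro
      group_atom_perms group_BijGroup)
    show "(\<lambda>\<pi>. restrict (act X \<pi>) (carrier X)) \<in> hom atom_perms (BijGroup (carrier X))"
    proof (rule homI)
      fix \<pi> \<sigma> :: "'a \<Rightarrow> 'a"
      assume "\<pi> \<in> carrier atom_perms" "\<sigma> \<in> carrier atom_perms"
      then have perm: "permutation \<pi>" "permutation \<sigma>" by (simp_all add: atom_perms_def)
      then have "restrict (act X (\<pi> \<circ> \<sigma>)) (carrier X) =
          compose (carrier X) (restrict (act X \<pi>) (carrier X)) (restrict (act X \<sigma>) (carrier X))"
        unfolding compose_def using * by (intro restrict_ext) simp
      then show "restrict (act X (\<pi> \<otimes>\<^bsub>atom_perms\<^esub> \<sigma>)) (carrier X) =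
          restrict (act X \<pi>) (carrier X) \<otimes>\<^bsub>BijGroup (carrier X)\<^esub> restrict (act X \<sigma>) (carrier X)"
        using bij perm by (simp add: BijGroup_def atom_perms_def)
    qed (use bij in \<open>simp add: BijGroup_def atom_perms_def\<close>)
  qed
qed

lemma act_closed: "is_sa_set X \<Longrightarrow> permutation \<pi> \<Longrightarrow> x \<in> carrier X \<Longrightarrow> act X \<pi> x \<in> carrier X"
  and act_id: "is_sa_set X \<Longrightarrow> x \<in> carrier X \<Longrightarrow> act X id x = x"
  and act_comp: "is_sa_set X \<Longrightarrow> permutation \<pi> \<Longrightarrow> permutation \<sigma> \<Longrightarrow> x \<in> carrier X \<Longrightarrow>
        act X (\<pi> \<circ> \<sigma>) x = act X \<pi> (act X \<sigma> x)"
  by (auto simp: is_sa_set_iff)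

lemma act_inverse:
  assumes "is_sa_set X" "permutation \<pi>" "x \<in> carrier X"
  shows "act X (inv_into UNIV \<pi>) (act X \<pi> x) = x" "act X \<pi> (act X (inv_into UNIV \<pi>) x) = x"
  using assms by (metis act_comp act_id permutation_inverse permutation_inv_comp)+

lemma inj_on_act: "is_sa_set X \<Longrightarrow> permutation \<pi> \<Longrightarrow> inj_on (act X \<pi>) (carrier X)"
  by (metis act_inverse(1) inj_onI)

lemma act_image_carrier:
  assumes "is_sa_set X" "permutation \<pi>"
  shows "act X \<pi> ` carrier X = carrier X"
proof
  show "carrier X \<subseteq> act X \<pi> ` carrier X"
    using assms by (metis act_closed act_inverse(2) permutation_inverse image_eqI subsetI)
qed (use assms act_closed in auto)

lemma supports_mono: "supports X S x \<Longrightarrow> S \<subseteq> T \<Longrightarrow> supports X T x"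
  by (auto simp: supports_iff)

text \<open>By conjugation: if \<sigma> fixes the image of \<open>S\<close> under \<pi> pointwise,
  then \<open>?\<tau>\<close>, the conjugate of \<sigma> by \<pi>, fixes \<open>S\<close> pointwise
  and hence fixes \<open>x\<close>. This makes the finitely supported elements closed under the
  action.\<close>

lemma supports_act:
  assumes "is_sa_set X" "x \<in> carrier X" "supports X S x" "permutation \<pi>"
  shows "supports X (\<pi> ` S) (act X \<pi> x)"
  unfolding supports_iff
proof (intro allI impI)
  fix \<sigma> assume \<sigma>: "permutation \<sigma>" "\<forall>a\<in>\<pi> ` S. \<sigma> a = a"
  let ?\<tau> = "inv_into UNIV \<pi> \<circ> (\<sigma> \<circ> \<pi>)"
  have bij: "bij \<pi>" using assms(4) permutation_bijective by blast
  have \<tau>: "permutation ?\<tau>"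
    by (intro permutation_compose permutation_inverse assms(4) \<sigma>(1))
  moreover have "\<forall>a\<in>S. ?\<tau> a = a"
    using \<sigma> bij by (auto simp: bij_is_inj)
  ultimately have "act X ?\<tau> x = x"
    using assms(3) by (auto simp: supports_iff)
  moreover have "\<sigma> \<circ> \<pi> = \<pi> \<circ> ?\<tau>"
    using permutation_inv_comp(2)[OF assms(4)] by (simp add: comp_assoc[symmetric])
  ultimately show "act X \<sigma> (act X \<pi> x) = act X \<pi> x"
    by (metis act_comp assms(1,2,4) \<sigma>(1) \<tau>)
qed

lemma finitely_supported_act:
  "is_sa_set X \<Longrightarrow> x \<in> carrier X \<Longrightarrow> finitely_supported X x \<Longrightarrow> permutation \<pi> \<Longrightarrow>
     finitely_supported X (act X \<pi> x)"
  unfolding finitely_supported_def by (meson finite_imageI supports_act)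

text \<open>A permutation that fixes \<open>S\<close> pointwise is a finite product of
  transpositions of atoms that it moves, and all of these lie outside \<open>S\<close>. Support can
  therefore be tested on transpositions alone.\<close>

lemma supports_iff_transpose:
  assumes X: "is_sa_set X" "x \<in> carrier X"
  shows "supports X S x \<longleftrightarrow> (\<forall>a b. a \<notin> S \<longrightarrow> b \<notin> S \<longrightarrow> act X (transpose a b) x = x)"
proof
  assume "supports X S x"
  then show "\<forall>a b. a \<notin> S \<longrightarrow> b \<notin> S \<longrightarrow> act X (transpose a b) x = x"
    unfolding supports_iff by (metis permutation_swap_id transpose_apply_other)
next
  assume fixed: "\<forall>a b. a \<notin> S \<longrightarrow> b \<notin> S \<longrightarrow> act X (transpose a b) x = x"
  show "supports X S x"
    unfolding supports_iff
  proof (intro allI impI)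
    fix \<pi> assume \<pi>: "permutation \<pi>" "\<forall>a\<in>S. \<pi> a = a"
    \<comment> \<open>\<open>D\<close> is finite since \<pi> is a finite product of transpositions,
      and disjoint from \<open>S\<close> since \<pi> fixes \<open>S\<close>. It stays the same
      throughout the induction, so every transposition split off avoids \<open>S\<close>.\<close>
    define D where "D = {a. \<pi> a \<noteq> a}"
    have "D \<inter> S = {}"
      using \<pi>(2) by (auto simp: D_def)
    have "\<pi> permutes D" "finite D"
      using \<pi> permutation[of \<pi>] by (auto simp: D_def permutes_def bij_iff)
    then show "act X \<pi> x = x"
    proof (induction \<pi> rule: permutes_induct)
      case id
      show ?case using X by (rule act_id)
    next
      case (swap a b p)
      have ab: "a \<notin> S" "b \<notin> S"
        using swap.hyps(1,2) \<open>D \<inter> S = {}\<close> by auto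
      have p: "permutation p"
        by (rule permutes_imp_permutation[OF \<open>finite D\<close> \<open>p permutes D\<close>])
      have "act X (transpose a b \<circ> p) x = act X (transpose a b) (act X p x)"
        by (rule act_comp[OF X(1) permutation_swap_id p X(2)])
      also have "\<dots> = x"
        using swap.IH fixed ab by simp
      finally show ?case .
    qed
  qed
qed

section \<open>Counting supported elements\<close>

lemma invariant_setD:
  "invariant_set X \<Longrightarrow> is_sa_set X"
  "invariant_set X \<Longrightarrow> x \<in> carrier X \<Longrightarrow> finitely_supported X x"
  by (auto simp: invariant_set_def)

text \<open>All subsets uniformly supported by a given \<open>S\<close> lie in the set of elements
  supported by \<open>S\<close>, which is itself uniformly supported; it is enough to bound this
  largest one. The carrier qualifies as a finitely supported subset because every permutation maps
  it onto itself, so the empty set supports it.\<close>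

lemma FSM_non_uniformly_infinite_iff:
  "FSM_non_uniformly_infinite X \<longleftrightarrow>
     invariant_set X \<and> (\<forall>S. finite S \<longrightarrow> finite {x \<in> carrier X. supports X S x})"
proof -
  have "carrier X \<in> carrier (pow_fs X)" if "invariant_set X"
  proof -
    have "supports (pow_set X) {} (carrier X)"
      using that by (auto simp: supports_iff pow_set_def act_image_carrier invariant_setD)
    then show ?thesis
      by (auto simp: pow_fs_def fs_part_def finitely_supported_def pow_set_def)
  qed
  moreover have "(\<exists>W\<subseteq>carrier X. infinite W \<and> uniformly_supported X W) \<longleftrightarrow>
      (\<exists>S. finite S \<and> infinite {x \<in> carrier X. supports X S x})" (is "?L \<longleftrightarrow> ?R")
  proof
    assume ?L
    then obtain W S where W: "W \<subseteq> carrier X" "infinite W" "finite S" "\<forall>x\<in>W. supports X S x"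
      by (auto simp: uniformly_supported_def)
    then have "W \<subseteq> {x \<in> carrier X. supports X S x}" by auto
    with W show ?R by (meson finite_subset)
  next
    assume ?R
    then obtain S where S: "finite S" "infinite {x \<in> carrier X. supports X S x}" by blast
    then show ?L
      by (intro exI[of _ "{x \<in> carrier X. supports X S x}"]) (auto simp: uniformly_supported_def)
  qed
  ultimately show ?thesis
    by (auto simp: FSM_non_uniformly_infinite_def FSM_non_uniformly_infinite_in_def
        FSM_uniformly_infinite_def)
qed

lemma FSM_non_uniformly_infiniteI:
  assumes "is_sa_set X" "\<And>x. x \<in> carrier X \<Longrightarrow> finitely_supported X x"
    and "\<And>S. finite S \<Longrightarrow> finite {x \<in> carrier X. supports X S x}"
  shows "FSM_non_uniformly_infinite X"
  using assms by (simp add: FSM_non_uniformly_infinite_iff invariant_set_def)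

lemma FSM_non_uniformly_infiniteD:
  assumes "FSM_non_uniformly_infinite X"
  shows "is_sa_set X" "\<And>x. x \<in> carrier X \<Longrightarrow> finitely_supported X x"
    and "\<And>S. finite S \<Longrightarrow> finite {x \<in> carrier X. supports X S x}"
  using assms by (auto simp: FSM_non_uniformly_infinite_iff invariant_set_def)

text \<open>An equivariant bijection preserves and reflects supports. It serves to transport the
  property along complementation, along the packing into \<open>hf\<close>, and along the embeddings
  into \<open>obj\<close>.\<close>

lemma FSM_non_uniformly_infinite_image:
  assumes Y: "FSM_non_uniformly_infinite Y"
    and carrier: "carrier X = c ` carrier Y" and inj: "inj_on c (carrier Y)"
    and act: "\<And>\<pi> y. permutation \<pi> \<Longrightarrow> y \<in> carrier Y \<Longrightarrow> act X \<pi> (c y) = c (act Y \<pi> y)"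
  shows "FSM_non_uniformly_infinite X"
proof (rule FSM_non_uniformly_infiniteI)
  note Y_sa = FSM_non_uniformly_infiniteD(1)[OF Y]
  show "is_sa_set X"
    using Y_sa act by (auto simp: is_sa_set_iff carrier permutation_compose)
  \<comment> \<open>Injectivity of \<open>c\<close> cancels it on both sides of the fixed-point
    equation; closure puts \<open>act Y \<pi> y\<close> into the carrier, where \<open>c\<close> is
    injective.\<close>
  have supp: "supports X S (c y) \<longleftrightarrow> supports Y S y" if "y \<in> carrier Y" for S y
    using that Y_sa act inj by (auto simp: supports_iff act_closed inj_on_eq_iff)
  show "finitely_supported X x" if "x \<in> carrier X" for x
    using that FSM_non_uniformly_infiniteD(2)[OF Y]
    by (auto simp: finitely_supported_def carrier supp)
  show "finite {x \<in> carrier X. supports X S x}" if "finite S" for S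
  proof -
    have "{x \<in> carrier X. supports X S x} = c ` {y \<in> carrier Y. supports Y S y}"
      by (auto simp: carrier supp)
    then show ?thesis
      using FSM_non_uniformly_infiniteD(3)[OF Y that] by simp
  qed
qed

lemma fs_part_simps [simp]:
  "carrier (fs_part X) = {x \<in> carrier X. finitely_supported X x}"
  "act (fs_part X) = act X"
  "supports (fs_part X) = supports X"
  "finitely_supported (fs_part X) = finitely_supported X"
  by (auto simp: fs_part_def supports_iff finitely_supported_def fun_eq_iff)

text \<open>\<open>X\<close> may contain elements without finite support, as full powersets and full
  function sets can. Passing to \<open>fs_part\<close> discards these and leaves the supports of the
  others unchanged.\<close>

lemma FSM_non_uniformly_infinite_fs_part:
  assumes "is_sa_set X" "\<And>S. finite S \<Longrightarrow> finite {x \<in> carrier X. supports X S x}"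
  shows "FSM_non_uniformly_infinite (fs_part X)"
proof (rule FSM_non_uniformly_infiniteI)
  show "is_sa_set (fs_part X)"
    using assms(1) by (auto simp: is_sa_set_iff finitely_supported_act)
  show "finite {x \<in> carrier (fs_part X). supports (fs_part X) S x}" if "finite S" for S
    by (rule finite_subset[OF _ assms(2)[OF that]]) auto
qed simp

section \<open>Powersets\<close>

lemma pow_set_simps [simp]:
  "carrier (pow_set X) = Pow (carrier X)" "act (pow_set X) \<pi> Z = act X \<pi> ` Z"
  by (simp_all add: pow_set_def)

lemma pow_fin_simps [simp]:
  "carrier (pow_fin X) = Fpow (carrier X)" "act (pow_fin X) \<pi> Z = act X \<pi> ` Z"
  by (simp_all add: pow_fin_def)

lemma is_sa_set_pow_set:
  assumes "is_sa_set X"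
  shows "is_sa_set (pow_set X)"
  unfolding is_sa_set_iff
proof (intro conjI allI impI ballI)
  fix Z assume "Z \<in> carrier (pow_set X)"
  then have Z: "Z \<subseteq> carrier X" by simp
  show "act (pow_set X) \<pi> Z \<in> carrier (pow_set X)" if "permutation \<pi>" for \<pi>
    using Z act_closed[OF assms that] by auto
  show "act (pow_set X) id Z = Z"
    using Z act_id[OF assms] by (simp add: subset_iff cong: image_cong)
  show "act (pow_set X) (\<pi> \<circ> \<sigma>) Z = act (pow_set X) \<pi> (act (pow_set X) \<sigma> Z)"
    if "permutation \<pi>" "permutation \<sigma>" for \<pi> \<sigma>
    using Z act_comp[OF assms that] by (simp add: subset_iff image_image cong: image_cong)
qed

lemma is_sa_set_pow_fin:
  assumes "is_sa_set X"
  shows "is_sa_set (pow_fin X)"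
  using is_sa_set_pow_set[OF assms] unfolding is_sa_set_iff by (auto simp: Fpow_def)

text \<open>Pigeonhole gives \<open>c \<noteq> d\<close> with \<open>(a c)x = (a d)x\<close>, so \<open>x = (a c)(a d)x = (a d)(c d)x\<close>, where
  \<open>(c d)\<close> fixes \<open>x\<close>.\<close>
lemma finite_orbit_transpose:
  fixes X :: "('a, 'x) sa_set"
  assumes inf: "infinite (UNIV :: 'a set)" and X: "is_sa_set X" "x \<in> carrier X"
    and T: "finite T" "supports X T x" and S: "finite S" and a: "a \<notin> S"
    and Z: "finite Z" "\<And>a b. a \<notin> S \<Longrightarrow> b \<notin> S \<Longrightarrow> act X (transpose a b) x \<in> Z"
  obtains d where "d \<notin> S" "d \<notin> T" "act X (transpose a d) x = x"
proof -
  let ?C = "- (S \<union> T \<union> {a})"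
  have "infinite ?C"
    using inf S T by (simp add: Compl_eq_Diff_UNIV)
  moreover have "(\<lambda>c. act X (transpose a c) x) ` ?C \<subseteq> Z"
    using a Z(2) by auto
  ultimately have "\<not> inj_on (\<lambda>c. act X (transpose a c) x) ?C"
    using Z(1) finite_imageD finite_subset by blast
  then obtain c d where cd: "c \<in> ?C" "d \<in> ?C" "c \<noteq> d"
      "act X (transpose a c) x = act X (transpose a d) x"
    by (auto simp: inj_on_def)
  note comp = act_comp[OF X(1) permutation_swap_id permutation_swap_id X(2)]
  have "x = act X (transpose a c \<circ> transpose a c) x"
    using X by (simp add: act_id)
  also have "\<dots> = act X (transpose a c \<circ> transpose a d) x"
    using cd(4) by (simp only: comp)
  also have "transpose a c \<circ> transpose a d = transpose a d \<circ> transpose c d"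
    using cd by (auto simp: fun_eq_iff transpose_def)
  also have "act X \<dots> x = act X (transpose a d) (act X (transpose c d) x)"
    by (rule comp)
  also have "act X (transpose c d) x = x"
    using T(2) cd supports_iff_transpose[OF X] by auto
  finally show ?thesis
    using that cd by auto
qed

text \<open>Each of \<open>a\<close> and \<open>b\<close> can be swapped with an atom outside the
  finite support \<open>T\<close> without changing \<open>x\<close>, and swapping two such atoms
  with each other fixes \<open>x\<close> as well. These swaps generate the swap of \<open>a\<close>
  and \<open>b\<close>. In the application \<open>Z\<close> is a finite set that contains
  \<open>x\<close> and is supported by \<open>S\<close>.\<close>

lemma finite_orbit_supports:
  fixes X :: "('a, 'x) sa_set"
  assumes inf: "infinite (UNIV :: 'a set)" and X: "is_sa_set X" "x \<in> carrier X"
    and fs: "finitely_supported X x" and S: "finite S"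
    and Z: "finite Z" "\<And>a b. a \<notin> S \<Longrightarrow> b \<notin> S \<Longrightarrow> act X (transpose a b) x \<in> Z"
  shows "supports X S x"
  unfolding supports_iff_transpose[OF X]
proof (intro allI impI)
  fix a b assume ab: "a \<notin> S" "b \<notin> S"
  obtain T where T: "finite T" "supports X T x"
    using fs by (auto simp: finitely_supported_def)
  obtain d where d: "d \<notin> S" "d \<notin> T" "act X (transpose a d) x = x"
    using finite_orbit_transpose[OF inf X T S ab(1) Z] by blast
  obtain e where e: "e \<notin> S" "e \<notin> T" "act X (transpose b e) x = x"
    using finite_orbit_transpose[OF inf X T S ab(2) Z] by blast
  have de: "act X (transpose d e) x = x"
    using T(2) d e supports_iff_transpose[OF X] by auto
  note comp = act_comp[OF X(1) permutation_swap_id _ X(2)]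
  \<comment> \<open>The swaps (a d), (d e) and (b e) fix \<open>x\<close>. Conjugating (b e) by (d
    e) gives (b d), and conjugating (b d) by (a d) gives (a b). These identities may fail when atoms
    coincide, so such cases are split off.\<close>
  show "act X (transpose a b) x = x"
  proof (cases "a = b \<or> b = d \<or> a = e")
    case True
    then show ?thesis
      using d e X by (auto simp: transpose_commute act_id)
  next
    case False
    have *: "act X (transpose b d) x = x"
    proof (cases "d = e \<or> b = e")
      case False
      then have "transpose b d = transpose d e \<circ> (transpose b e \<circ> transpose d e)"
        using \<open>\<not> (a = b \<or> b = d \<or> a = e)\<close> by (auto simp: fun_eq_iff transpose_def)
      then show ?thesis
        using de e by (simp add: comp permutation_compose permutation_swap_id)
    qed (use e de in \<open>auto simp: transpose_commute\<close>)
    have "transpose a b = transpose a d \<circ> (transpose b d \<circ> transpose a d)" if "a \<noteq> d"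
      using False that by (auto simp: fun_eq_iff transpose_def)
    then show ?thesis
      using * d by (cases "a = d") (simp_all add: comp permutation_compose permutation_swap_id transpose_commute)
  qed
qed

text \<open>If \<open>S\<close> supports a finite \<open>Z\<close>, swaps outside \<open>S\<close>
  map \<open>Z\<close> to itself, so the images of any \<open>x\<close> in \<open>Z\<close> stay in
  \<open>Z\<close>, and \<open>finite_orbit_supports\<close> applies with \<open>Z\<close> as the
  finite bound. Hence \<open>Z\<close> is a subset of the finite set of elements supported by
  \<open>S\<close>.\<close>

lemma FSM_non_uniformly_infinite_pow_fin:
  fixes X :: "('a, 'x) sa_set"
  assumes inf: "infinite (UNIV :: 'a set)" and X: "FSM_non_uniformly_infinite X"
  shows "FSM_non_uniformly_infinite (pow_fin X)"
proof (rule FSM_non_uniformly_infiniteI)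
  note X_sa = FSM_non_uniformly_infiniteD(1)[OF X] and X_fs = FSM_non_uniformly_infiniteD(2)[OF X]
  show sa: "is_sa_set (pow_fin X)"
    by (rule is_sa_set_pow_fin[OF X_sa])
  show "finitely_supported (pow_fin X) Z" if "Z \<in> carrier (pow_fin X)" for Z
  proof -
    have Z: "finite Z" "Z \<subseteq> carrier X" using that by (auto simp: Fpow_def)
    then have "\<forall>x\<in>Z. \<exists>S. finite S \<and> supports X S x"
      using X_fs by (auto simp: finitely_supported_def)
    then obtain S where S: "\<forall>x\<in>Z. finite (S x) \<and> supports X (S x) x"
      by metis
    then have "supports (pow_fin X) (\<Union>x\<in>Z. S x) Z"
      by (auto simp: supports_iff image_iff)
    then show ?thesis
      using S Z by (auto simp: finitely_supported_def)
  qed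
  show "finite {Z \<in> carrier (pow_fin X). supports (pow_fin X) S Z}" if S: "finite S" for S
  proof -
    have "supports X S x" if "Z \<in> carrier (pow_fin X)" "supports (pow_fin X) S Z" "x \<in> Z" for Z x
    proof (rule finite_orbit_supports[OF inf X_sa _ X_fs S])
      show "finite Z" "x \<in> carrier X" "x \<in> carrier X"
        using that by (auto simp: Fpow_def)
      show "act X (transpose a b) x \<in> Z" if ab: "a \<notin> S" "b \<notin> S" for a b
        using that \<open>supports (pow_fin X) S Z\<close> \<open>x \<in> Z\<close>
          supports_iff_transpose[OF sa \<open>Z \<in> carrier (pow_fin X)\<close>, of S] by auto
    qed
    then have "{Z \<in> carrier (pow_fin X). supports (pow_fin X) S Z} \<subseteq>
        Pow {x \<in> carrier X. supports X S x}"
      by (auto simp: Fpow_def)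
    then show ?thesis
      using FSM_non_uniformly_infiniteD(3)[OF X S] by (meson finite_Pow_iff finite_subset)
  qed
qed

text \<open>Complementation is a bijection from the finite to the cofinite subsets. It is
  equivariant because each permutation acts injectively and maps the carrier onto itself.\<close>

lemma FSM_non_uniformly_infinite_pow_cofin:
  assumes "infinite (UNIV :: 'a set)" "FSM_non_uniformly_infinite (X :: ('a, 'x) sa_set)"
  shows "FSM_non_uniformly_infinite (pow_cofin X)"
proof (rule FSM_non_uniformly_infinite_image[where c = "\<lambda>Z. carrier X - Z"])
  note X_sa = FSM_non_uniformly_infiniteD(1)[OF assms(2)]
  show "FSM_non_uniformly_infinite (pow_fin X)"
    using assms by (rule FSM_non_uniformly_infinite_pow_fin)
  show "carrier (pow_cofin X) = (\<lambda>Z. carrier X - Z) ` carrier (pow_fin X)"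
  proof (intro equalityI subsetI)
    fix Z assume "Z \<in> carrier (pow_cofin X)"
    then show "Z \<in> (\<lambda>Z. carrier X - Z) ` carrier (pow_fin X)"
      by (intro image_eqI[of _ _ "carrier X - Z"]) (auto simp: pow_cofin_def Fpow_def)
  qed (auto simp: pow_cofin_def Fpow_def double_diff)
  show "inj_on (\<lambda>Z. carrier X - Z) (carrier (pow_fin X))"
    by (auto simp: inj_on_def Fpow_def)
  show "act (pow_cofin X) \<pi> (carrier X - Z) = carrier X - act (pow_fin X) \<pi> Z"
    if "permutation \<pi>" "Z \<in> carrier (pow_fin X)" for \<pi> Z
    using that inj_on_image_set_diff[OF inj_on_act[OF X_sa that(1)], of "carrier X" Z]
      act_image_carrier[OF X_sa that(1)]
    by (simp add: pow_cofin_def Fpow_def)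
qed

text \<open>Depth 0 is a copy of \<open>X\<close> under \<open>Base\<close>, and each further level
  is a copy of \<open>pow_fin\<close> of the level below. \<open>Abs_fset\<close> is injective there
  because it is applied to finite sets only.\<close>

lemma FSM_non_uniformly_infinite_iter_pow_fin:
  fixes X :: "('a, 'x) sa_set"
  assumes "infinite (UNIV :: 'a set)" "FSM_non_uniformly_infinite X"
  shows "FSM_non_uniformly_infinite (iter_pow_fin n X)"
proof (induction n)
  case 0
  show ?case
    by (rule FSM_non_uniformly_infinite_image[OF assms(2), where c = Base])
      (auto simp: iter_pow_fin_def inj_on_def)
next
  case (Suc n)
  show ?case
  proof (rule FSM_non_uniformly_infinite_image[where c = "\<lambda>Z. HSet (Abs_fset Z)"])
    show "FSM_non_uniformly_infinite (pow_fin (iter_pow_fin n X))"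
      by (rule FSM_non_uniformly_infinite_pow_fin[OF assms(1) Suc.IH])
    show "carrier (iter_pow_fin (Suc n) X) =
        (\<lambda>Z. HSet (Abs_fset Z)) ` carrier (pow_fin (iter_pow_fin n X))"
    proof (intro equalityI subsetI)
      fix z assume "z \<in> carrier (iter_pow_fin (Suc n) X)"
      then obtain Z where "z = HSet Z" "fset Z \<subseteq> iter_pow_fin_carrier n (carrier X)"
        by (auto simp: iter_pow_fin_def)
      then show "z \<in> (\<lambda>Z. HSet (Abs_fset Z)) ` carrier (pow_fin (iter_pow_fin n X))"
        by (intro image_eqI[of _ _ "fset Z"]) (auto simp: iter_pow_fin_def Fpow_def fset_inverse)
    qed (auto simp: iter_pow_fin_def Fpow_def Abs_fset_inverse)
    show "inj_on (\<lambda>Z. HSet (Abs_fset Z)) (carrier (pow_fin (iter_pow_fin n X)))"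
      by (auto simp: inj_on_def Fpow_def Abs_fset_inject)
    show "act (iter_pow_fin (Suc n) X) \<pi> (HSet (Abs_fset Z)) =
        HSet (Abs_fset (act (pow_fin (iter_pow_fin n X)) \<pi> Z))"
      if "Z \<in> carrier (pow_fin (iter_pow_fin n X))" for \<pi> Z
      using that by (auto simp: iter_pow_fin_def Fpow_def fset_inject[symmetric] Abs_fset_inverse)
  qed
qed

section \<open>Function sets, tuples and disjoint unions\<close>

lemma atoms_simps [simp]: "carrier atoms = UNIV" "act atoms \<pi> a = \<pi> a"
  by (simp_all add: atoms_def)

lemma funs_atoms_simps [simp]:
  "carrier (funs atoms Y) = {f. \<forall>a. f a \<in> carrier Y}"
  "act (funs atoms Y) \<pi> f = (\<lambda>a. act Y \<pi> (f (inv_into UNIV \<pi> a)))"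
  by (auto simp: funs_def)

lemma is_sa_set_funs_atoms:
  fixes Y :: "('a, 'y) sa_set"
  assumes "is_sa_set Y"
  shows "is_sa_set (funs atoms Y)"
  unfolding is_sa_set_iff
proof (intro conjI allI impI ballI)
  fix f assume "f \<in> carrier (funs (atoms :: ('a, 'a) sa_set) Y)"
  then have f: "f a \<in> carrier Y" for a by simp
  show "act (funs atoms Y) \<pi> f \<in> carrier (funs atoms Y)" if "permutation \<pi>" for \<pi>
    using f act_closed[OF assms that] by simp
  show "act (funs atoms Y) id f = f"
    using f act_id[OF assms] by simp
  show "act (funs atoms Y) (\<pi> \<circ> \<sigma>) f = act (funs atoms Y) \<pi> (act (funs atoms Y) \<sigma> f)"
    if "permutation \<pi>" "permutation \<sigma>" for \<pi> \<sigma>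
    using f act_comp[OF assms that] that by (simp add: o_inv_distrib permutation_bijective)
qed

text \<open>Evaluating the fixed-point equation of \<open>f\<close> at \<open>\<pi> a\<close>
  cancels the inverse permutation; support thus becomes equivariance of \<open>f\<close> under the
  permutations fixing \<open>S\<close>.\<close>

lemma supports_funs_atoms:
  assumes f: "supports (funs atoms Y) S f" and \<pi>: "permutation \<pi>" "\<forall>a\<in>S. \<pi> a = a"
  shows "act Y \<pi> (f a) = f (\<pi> a)"
proof -
  have "(\<lambda>a. act Y \<pi> (f (inv_into UNIV \<pi> a))) = f"
    using f \<pi> by (simp add: supports_iff)
  then have "act Y \<pi> (f (inv_into UNIV \<pi> (\<pi> a))) = f (\<pi> a)"
    by (rule fun_cong)
  then show ?thesis
    using \<pi>(1) by (simp add: bij_is_inj permutation_bijective)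
qed

text \<open>Restriction to \<open>?T\<close> embeds the functions supported by \<open>S\<close> into
  a set of functions between two finite sets.\<close>

lemma FSM_non_uniformly_infinite_fs_funs_atoms:
  fixes Y :: "('a, 'y) sa_set"
  assumes inf: "infinite (UNIV :: 'a set)" and Y: "FSM_non_uniformly_infinite Y"
  shows "FSM_non_uniformly_infinite (fs_funs atoms Y)"
  unfolding fs_funs_def
proof (rule FSM_non_uniformly_infinite_fs_part)
  show "is_sa_set (funs atoms Y)"
    by (rule is_sa_set_funs_atoms[OF FSM_non_uniformly_infiniteD(1)[OF Y]])
  fix S :: "'a set" assume S: "finite S"
  then obtain b where b: "b \<notin> S"
    using inf ex_new_if_finite by blast
  define F where "F = {f \<in> carrier (funs atoms Y). supports (funs atoms Y) S f}"
  let ?T = "insert b S"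
  have F: "supports (funs atoms Y) S f" "f a \<in> carrier Y" if "f \<in> F" for f a
    using that by (auto simp: F_def)
  have "inj_on (\<lambda>f. restrict f ?T) F"
  proof (rule inj_onI)
    fix f g assume fg: "f \<in> F" "g \<in> F" "restrict f ?T = restrict g ?T"
    have eq: "f a = g a" if "a \<in> ?T" for a
      using fg(3) that by (metis restrict_apply')
    \<comment> \<open>The swap of \<open>b\<close> and \<open>a\<close> fixes \<open>S\<close>, so
      it carries the value at \<open>b\<close> to the value at \<open>a\<close>, for
      \<open>f\<close> and for \<open>g\<close> alike.\<close>
    have "f a = g a" if "a \<notin> S" for a
    proof -
      have swap: "\<forall>s\<in>S. transpose b a s = s"
        using b that by (auto simp: transpose_def)
      have "f a = act Y (transpose b a) (f b)"
        using supports_funs_atoms[OF F(1)[OF fg(1)] permutation_swap_id swap] by simp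
      also have "\<dots> = act Y (transpose b a) (g b)"
        by (simp add: eq)
      also have "\<dots> = g a"
        using supports_funs_atoms[OF F(1)[OF fg(2)] permutation_swap_id swap] by simp
      finally show ?thesis .
    qed
    then show "f = g"
      using eq by blast
  qed
  moreover have "(\<lambda>f. restrict f ?T) ` F \<subseteq> ?T \<rightarrow>\<^sub>E {y \<in> carrier Y. supports Y ?T y}"
  proof (intro image_subsetI restrict_PiE_iff[THEN iffD2] ballI CollectI conjI)
    fix f a assume f: "f \<in> F" and a: "a \<in> ?T"
    show "f a \<in> carrier Y"
      by (rule F(2)[OF f])
    \<comment> \<open>A permutation fixing \<open>?T\<close> fixes both \<open>S\<close> and the
      argument \<open>a\<close>, so by equivariance it fixes \<open>f a\<close>.\<close>
    show "supports Y ?T (f a)"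
      unfolding supports_iff using supports_funs_atoms[OF F(1)[OF f]] a by auto
  qed
  moreover have "finite (?T \<rightarrow>\<^sub>E {y \<in> carrier Y. supports Y ?T y})"
    using S by (intro finite_PiE FSM_non_uniformly_infiniteD(3)[OF Y]) auto
  ultimately show "finite {f \<in> carrier (funs atoms Y). supports (funs atoms Y) S f}"
    unfolding F_def[symmetric] by (meson finite_imageD finite_subset)
qed

lemma supports_inj_tuples: "supports (inj_tuples X) S xs \<longleftrightarrow> (\<forall>x\<in>set xs. supports X S x)"
  by (auto simp: supports_iff inj_tuples_def list_eq_iff_nth_eq all_set_conv_all_nth)

text \<open>The entries of a supported tuple come from the finite set of supported elements, and
  distinctness bounds the length of a tuple over that set.\<close>

lemma FSM_non_uniformly_infinite_inj_tuples:
  assumes X: "FSM_non_uniformly_infinite X"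
  shows "FSM_non_uniformly_infinite (inj_tuples X)"
proof (rule FSM_non_uniformly_infiniteI)
  note X_sa = FSM_non_uniformly_infiniteD(1)[OF X] and X_fs = FSM_non_uniformly_infiniteD(2)[OF X]
  show "is_sa_set (inj_tuples X)"
    unfolding is_sa_set_iff
  proof (intro conjI allI impI ballI)
    fix xs assume "xs \<in> carrier (inj_tuples X)"
    then have xs: "distinct xs" "\<And>x. x \<in> set xs \<Longrightarrow> x \<in> carrier X"
      by (auto simp: inj_tuples_def)
    show "act (inj_tuples X) \<pi> xs \<in> carrier (inj_tuples X)" if "permutation \<pi>" for \<pi>
      using xs act_closed[OF X_sa that] inj_on_act[OF X_sa that]
      by (auto simp: inj_tuples_def distinct_map intro: inj_on_subset)
    show "act (inj_tuples X) id xs = xs"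
      using xs act_id[OF X_sa] by (simp add: inj_tuples_def map_idI)
    show "act (inj_tuples X) (\<pi> \<circ> \<sigma>) xs = act (inj_tuples X) \<pi> (act (inj_tuples X) \<sigma> xs)"
      if "permutation \<pi>" "permutation \<sigma>" for \<pi> \<sigma>
      using xs act_comp[OF X_sa that] by (simp add: inj_tuples_def)
  qed
  show "finitely_supported (inj_tuples X) xs" if "xs \<in> carrier (inj_tuples X)" for xs
  proof -
    have "\<forall>x\<in>set xs. \<exists>S. finite S \<and> supports X S x"
      using X_fs that by (auto simp: finitely_supported_def inj_tuples_def)
    then obtain S where S: "\<And>x. x \<in> set xs \<Longrightarrow> finite (S x) \<and> supports X (S x) x"
      by metis
    have "supports X (\<Union>x\<in>set xs. S x) x" if "x \<in> set xs" for x
      by (rule supports_mono[of X "S x"]) (use that S in auto)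
    then show ?thesis
      unfolding finitely_supported_def supports_inj_tuples using S by blast
  qed
  show "finite {xs \<in> carrier (inj_tuples X). supports (inj_tuples X) S xs}" if "finite S" for S
  proof -
    have "{xs \<in> carrier (inj_tuples X). supports (inj_tuples X) S xs} \<subseteq>
        {xs. set xs \<subseteq> {x \<in> carrier X. supports X S x} \<and> distinct xs}"
      by (auto simp: inj_tuples_def supports_inj_tuples[unfolded inj_tuples_def])
    then show ?thesis
      using FSM_non_uniformly_infiniteD(3)[OF X that] finite_subset finite_subset_distinct by blast
  qed
qed

section \<open>Finite Cartesian products of any length\<close>

lemma mem_listset_iff: "xs \<in> listset As \<longleftrightarrow> list_all2 (\<lambda>x A. x \<in> A) xs As"
  by (induction As arbitrary: xs) (auto simp: set_Cons_def list_all2_Cons2)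

lemma finite_listset: "(\<And>A. A \<in> set As \<Longrightarrow> finite A) \<Longrightarrow> finite (listset As)"
proof (induction As)
  case (Cons A As)
  have "listset (A # As) = (\<lambda>(x, xs). x # xs) ` (A \<times> listset As)"
    by (auto simp: set_Cons_def)
  then show ?case
    using Cons by simp
qed simp

lemma mem_cart_prod_iff:
  "xs \<in> carrier (cart_prod Xs) \<longleftrightarrow>
     length xs = length Xs \<and> (\<forall>i<length Xs. xs ! i \<in> carrier (Xs ! i))"
  by (auto simp: cart_prod_def mem_listset_iff list_all2_conv_all_nth)

lemma nth_act_cart_prod:
  "length xs = length Xs \<Longrightarrow> i < length Xs \<Longrightarrow> act (cart_prod Xs) \<pi> xs ! i = act (Xs ! i) \<pi> (xs ! i)"
  "length xs = length Xs \<Longrightarrow> length (act (cart_prod Xs) \<pi> xs) = length Xs"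
  by (simp_all add: cart_prod_def)

lemma supports_cart_prod:
  assumes "length xs = length Xs"
  shows "supports (cart_prod Xs) S xs \<longleftrightarrow> (\<forall>i<length Xs. supports (Xs ! i) S (xs ! i))"
  using assms by (auto simp: supports_iff list_eq_iff_nth_eq nth_act_cart_prod)

text \<open>Supports are computed componentwise, so the tuples supported by \<open>S\<close> lie in
  a finite product of finite sets.\<close>

lemma FSM_non_uniformly_infinite_cart_prod:
  assumes "\<And>X. X \<in> set Xs \<Longrightarrow> FSM_non_uniformly_infinite X"
  shows "FSM_non_uniformly_infinite (cart_prod Xs)"
proof (rule FSM_non_uniformly_infiniteI)
  have Xs: "FSM_non_uniformly_infinite (Xs ! i)" if "i < length Xs" for i
    using assms that by simp
  note D = FSM_non_uniformly_infiniteD[OF Xs]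
  show "is_sa_set (cart_prod Xs)"
    unfolding is_sa_set_iff
    by (auto simp: mem_cart_prod_iff list_eq_iff_nth_eq nth_act_cart_prod act_closed act_id act_comp D)
  show "finitely_supported (cart_prod Xs) xs" if "xs \<in> carrier (cart_prod Xs)" for xs
  proof -
    \<comment> \<open>The bound on \<open>i\<close> stands below the existential so that
      \<open>choice\<close> yields a function on all indices.\<close>
    have "\<forall>i. \<exists>S. i < length Xs \<longrightarrow> finite S \<and> supports (Xs ! i) S (xs ! i)"
      using that D(2) by (auto simp: mem_cart_prod_iff finitely_supported_def)
    from choice[OF this] obtain S
      where S: "\<forall>i. i < length Xs \<longrightarrow> finite (S i) \<and> supports (Xs ! i) (S i) (xs ! i)" ..
    have "supports (Xs ! i) (\<Union>i<length Xs. S i) (xs ! i)" if "i < length Xs" for i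
      by (rule supports_mono[of _ "S i"]) (use that S in auto)
    then have "supports (cart_prod Xs) (\<Union>i<length Xs. S i) xs"
      using that by (simp add: supports_cart_prod mem_cart_prod_iff)
    moreover have "finite (\<Union>i<length Xs. S i)"
      using S by simp
    ultimately show ?thesis
      by (auto simp: finitely_supported_def)
  qed
  show "finite {xs \<in> carrier (cart_prod Xs). supports (cart_prod Xs) S xs}" if "finite S" for S
  proof (rule finite_subset)
    show "{xs \<in> carrier (cart_prod Xs). supports (cart_prod Xs) S xs} \<subseteq>
        listset (map (\<lambda>X. {x \<in> carrier X. supports X S x}) Xs)"
      by (auto simp: mem_cart_prod_iff supports_cart_prod mem_listset_iff list_all2_conv_all_nth)
    show "finite (listset (map (\<lambda>X. {x \<in> carrier X. supports X S x}) Xs))"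
      by (rule finite_listset) (use FSM_non_uniformly_infiniteD(3)[OF assms that] in auto)
  qed
qed

section \<open>Disjoint unions, of lists of sets and of two sets\<close>

lemma FSM_non_uniformly_infinite_disj_unions:
  assumes "\<And>X. X \<in> set Xs \<Longrightarrow> FSM_non_uniformly_infinite X"
  shows "FSM_non_uniformly_infinite (disj_unions Xs)"
proof (rule FSM_non_uniformly_infiniteI)
  have Xs: "FSM_non_uniformly_infinite (Xs ! i)" if "i < length Xs" for i
    using assms that by simp
  note D = FSM_non_uniformly_infiniteD[OF Xs]
  have supp: "supports (disj_unions Xs) S (i, x) \<longleftrightarrow> supports (Xs ! i) S x" for S i x
    by (simp add: supports_iff disj_unions_def)
  show "is_sa_set (disj_unions Xs)"
    unfolding is_sa_set_iff by (auto simp: disj_unions_def act_closed act_id act_comp D)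
  show "finitely_supported (disj_unions Xs) p" if "p \<in> carrier (disj_unions Xs)" for p
    using that D(2) by (cases p) (auto simp: finitely_supported_def supp, auto simp: disj_unions_def)
  show "finite {p \<in> carrier (disj_unions Xs). supports (disj_unions Xs) S p}" if "finite S" for S
  proof -
    have "{p \<in> carrier (disj_unions Xs). supports (disj_unions Xs) S p} =
        (SIGMA i:{..<length Xs}. {x \<in> carrier (Xs ! i). supports (Xs ! i) S x})"
      using supp by (auto simp: disj_unions_def)
    then show ?thesis
      using D(3) that by auto
  qed
qed

lemma FSM_non_uniformly_infinite_disj_union:
  assumes X: "FSM_non_uniformly_infinite X" and Y: "FSM_non_uniformly_infinite Y"
  shows "FSM_non_uniformly_infinite (X \<uplus>\<^sub>s Y)"
proof (rule FSM_non_uniformly_infiniteI)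
  note D = FSM_non_uniformly_infiniteD[OF X] FSM_non_uniformly_infiniteD[OF Y]
  have supp: "supports (X \<uplus>\<^sub>s Y) S (Inl x) \<longleftrightarrow> supports X S x"
    "supports (X \<uplus>\<^sub>s Y) S (Inr y) \<longleftrightarrow> supports Y S y" for S x y
    by (simp_all add: supports_iff disj_union_def)
  have carrier: "carrier (X \<uplus>\<^sub>s Y) = carrier X <+> carrier Y"
    by (simp add: disj_union_def)
  show "is_sa_set (X \<uplus>\<^sub>s Y)"
    unfolding is_sa_set_iff by (auto simp: disj_union_def act_closed act_id act_comp D)
  show "finitely_supported (X \<uplus>\<^sub>s Y) z" if "z \<in> carrier (X \<uplus>\<^sub>s Y)" for z
    using that D(2,5) by (auto simp: finitely_supported_def supp carrier)
  show "finite {z \<in> carrier (X \<uplus>\<^sub>s Y). supports (X \<uplus>\<^sub>s Y) S z}" if "finite S" for S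
  proof -
    have "{z \<in> carrier (X \<uplus>\<^sub>s Y). supports (X \<uplus>\<^sub>s Y) S z} =
        {x \<in> carrier X. supports X S x} <+> {y \<in> carrier Y. supports Y S y}"
      by (auto simp: carrier supp)
    then show ?thesis
      using D(3,6) that by simp
  qed
qed

section \<open>Atoms and sets of atoms\<close>

lemma is_sa_set_atoms: "is_sa_set atoms"
  by (auto simp: is_sa_set_iff)

text \<open>An atom outside \<open>S\<close> is moved by its swap with another atom outside
  \<open>S\<close>, which exists because there are infinitely many atoms.\<close>

lemma supports_atoms_iff:
  assumes "infinite (UNIV :: 'a set)" "finite S"
  shows "supports atoms S (a :: 'a) \<longleftrightarrow> a \<in> S"
proof
  assume supp: "supports atoms S a"
  show "a \<in> S"
  proof (rule ccontr)
    assume a: "a \<notin> S"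
    obtain b where "b \<notin> insert a S"
      using assms ex_new_if_finite by (metis finite_insert)
    then show False
      using supp a supports_iff_transpose[OF is_sa_set_atoms, of a S] by auto
  qed
qed (simp add: supports_iff)

lemma FSM_non_uniformly_infinite_atoms:
  assumes "infinite (UNIV :: 'a set)"
  shows "FSM_non_uniformly_infinite (atoms :: ('a, 'a) sa_set)"
proof (rule FSM_non_uniformly_infiniteI[OF is_sa_set_atoms])
  show "finitely_supported atoms a" for a :: 'a
    unfolding finitely_supported_def
    by (intro exI[of _ "{a}"]) (simp add: supports_atoms_iff[OF assms])
  show "finite {a \<in> carrier atoms. supports atoms S (a :: 'a)}" if "finite S" for S
    using that by (rule rev_finite_subset) (auto simp: supports_atoms_iff[OF assms that])
qed

text \<open>Swaps outside \<open>S\<close> preserve a supported \<open>Z\<close>, so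
  \<open>Z\<close> contains either none or all of the atoms outside \<open>S\<close>. It is thus
  determined by its part inside \<open>S\<close> and one binary choice, which are the two images of
  \<open>Pow S\<close> in the proof.\<close>

lemma FSM_non_uniformly_infinite_pow_fs_atoms:
  "FSM_non_uniformly_infinite (pow_fs (atoms :: ('a, 'a) sa_set))"
  unfolding pow_fs_def
proof (rule FSM_non_uniformly_infinite_fs_part)
  show sa: "is_sa_set (pow_set (atoms :: ('a, 'a) sa_set))"
    by (rule is_sa_set_pow_set[OF is_sa_set_atoms])
  fix S :: "'a set" assume S: "finite S"
  have "Z \<in> (\<lambda>B. B) ` Pow S \<union> (\<lambda>B. B \<union> - S) ` Pow S" if "supports (pow_set atoms) S Z" for Z
  proof (cases "Z \<subseteq> S")
    case False
    then obtain a where a: "a \<in> Z" "a \<notin> S" by blast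
    have "b \<in> Z" if "b \<notin> S" for b
    proof -
      have "transpose a b ` Z = Z"
        using \<open>supports (pow_set atoms) S Z\<close> supports_iff_transpose[OF sa, of Z S] a that by auto
      then show ?thesis
        using a(1) by (metis imageI transpose_apply_first)
    qed
    then have "Z = (Z \<inter> S) \<union> - S" by blast
    then show ?thesis by blast
  qed auto
  then have "{Z \<in> carrier (pow_set atoms). supports (pow_set atoms) S Z} \<subseteq>
      (\<lambda>B. B) ` Pow S \<union> (\<lambda>B. B \<union> - S) ` Pow S"
    by blast
  then show "finite {Z \<in> carrier (pow_set atoms). supports (pow_set atoms) S Z}"
    using S by (meson finite_Pow_iff finite_UnI finite_imageI finite_subset)
qed

text \<open>The constructors of \<open>obj\<close> are injective and \<open>obj_act\<close> commutes
  with them, so sets living in different types can be moved into one type and collected in a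
  list.\<close>

lemma FSM_non_uniformly_infinite_as_obj:
  assumes "FSM_non_uniformly_infinite X" "inj_on c (carrier X)"
    and "\<And>\<pi> x. permutation \<pi> \<Longrightarrow> x \<in> carrier X \<Longrightarrow> obj_act \<pi> (c x) = c (act X \<pi> x)"
  shows "FSM_non_uniformly_infinite (as_obj c X)"
  by (rule FSM_non_uniformly_infinite_image[OF assms(1) _ assms(2)]) (simp_all add: as_obj_def assms(3))

theorem theorem3p8:
  assumes "infinite (UNIV :: 'a set)"
  shows
    "let A = (atoms :: ('a, 'a) sa_set); PA = pow_fs A; AA = fs_funs A A in
     \<comment> \<open>(1)\<close> FSM_non_uniformly_infinite A \<and>
     \<comment> \<open>(2)\<close> FSM_non_uniformly_infinite PA \<and>
     \<comment> \<open>(3)\<close> FSM_non_uniformly_infinite (inj_tuples A) \<and>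
     \<comment> \<open>(4)\<close> FSM_non_uniformly_infinite (fs_funs A PA) \<and>
     \<comment> \<open>(5)\<close> FSM_non_uniformly_infinite AA \<and>
     \<comment> \<open>(6)\<close> (\<forall>n. FSM_non_uniformly_infinite (fs_funs A (cart_prod (replicate n A)))) \<and>
     \<comment> \<open>(7)\<close> FSM_non_uniformly_infinite (fs_funs A (inj_tuples A)) \<and>
     \<comment> \<open>(8)\<close> FSM_non_uniformly_infinite (pow_fin A) \<and>
         FSM_non_uniformly_infinite (pow_cofin A) \<and>
         FSM_non_uniformly_infinite (pow_fin PA) \<and>
         FSM_non_uniformly_infinite (pow_fin AA) \<and>
     \<comment> \<open>(9)\<close> (\<forall>n\<ge>1. FSM_non_uniformly_infinite (iter_pow_fin n A) \<and>
                FSM_non_uniformly_infinite (iter_pow_fin n AA) \<and>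
                FSM_non_uniformly_infinite (iter_pow_fin n PA)) \<and>
     \<comment> \<open>(10)\<close> (\<forall>Xs. set Xs \<subseteq> {as_obj Atom A, as_obj Subset (pow_fin A), as_obj Subset (pow_cofin A),
                          as_obj Subset PA, as_obj AtomFun AA} \<longrightarrow>
                FSM_non_uniformly_infinite (cart_prod Xs)) \<and>
     \<comment> \<open>(11)\<close> FSM_non_uniformly_infinite (A \<uplus>\<^sub>s AA) \<and>
         FSM_non_uniformly_infinite (A \<uplus>\<^sub>s PA) \<and>
         FSM_non_uniformly_infinite (PA \<uplus>\<^sub>s AA) \<and>
         FSM_non_uniformly_infinite (A \<uplus>\<^sub>s PA \<uplus>\<^sub>s AA) \<and>
         (\<forall>Xs. set Xs \<subseteq> {as_obj Atom A, as_obj AtomFun AA, as_obj Subset PA} \<longrightarrow>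
                FSM_non_uniformly_infinite (disj_unions Xs))"
proof -
  let ?A = "atoms :: ('a, 'a) sa_set"
  let ?PA = "pow_fs ?A" and ?AA = "fs_funs ?A ?A"
  note A = FSM_non_uniformly_infinite_atoms[OF assms]
  note PA = FSM_non_uniformly_infinite_pow_fs_atoms[where 'a = 'a]
  note fs_fun = FSM_non_uniformly_infinite_fs_funs_atoms[OF assms]
  note AA = fs_fun[OF A]
  note pow_fin = FSM_non_uniformly_infinite_pow_fin[OF assms]
  note pow_cofin = FSM_non_uniformly_infinite_pow_cofin[OF assms A]
  note iter = FSM_non_uniformly_infinite_iter_pow_fin[OF assms]
  note prod = FSM_non_uniformly_infinite_cart_prod
  note sum = FSM_non_uniformly_infinite_disj_union
  have "FSM_non_uniformly_infinite (as_obj Atom ?A)"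
    by (rule FSM_non_uniformly_infinite_as_obj[OF A]) (auto simp: inj_on_def)
  moreover have "FSM_non_uniformly_infinite (as_obj Subset ?PA)"
    by (rule FSM_non_uniformly_infinite_as_obj[OF PA]) (auto simp: inj_on_def pow_fs_def)
  moreover have "FSM_non_uniformly_infinite (as_obj AtomFun ?AA)"
    by (rule FSM_non_uniformly_infinite_as_obj[OF AA]) (auto simp: inj_on_def fs_funs_def)
  moreover have "FSM_non_uniformly_infinite (as_obj Subset (pow_fin ?A))"
    by (rule FSM_non_uniformly_infinite_as_obj[OF pow_fin[OF A]]) (auto simp: inj_on_def)
  moreover have "FSM_non_uniformly_infinite (as_obj Subset (pow_cofin ?A))"
    by (rule FSM_non_uniformly_infinite_as_obj[OF pow_cofin]) (auto simp: inj_on_def pow_cofin_def)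
  \<comment> \<open>These are the five admissible factors of the products; the admissible summands
    of the disjoint unions are three of them.\<close>
  ultimately have obj: "FSM_non_uniformly_infinite X"
    if "X \<in> {as_obj Atom ?A, as_obj Subset (pow_fin ?A), as_obj Subset (pow_cofin ?A),
          as_obj Subset ?PA, as_obj AtomFun ?AA}" for X
    using that by auto
  have "FSM_non_uniformly_infinite (cart_prod (replicate n ?A))" for n
    by (rule prod) (use A in auto)
  moreover have "FSM_non_uniformly_infinite (cart_prod Xs)"
    if "set Xs \<subseteq> {as_obj Atom ?A, as_obj Subset (pow_fin ?A), as_obj Subset (pow_cofin ?A),
          as_obj Subset ?PA, as_obj AtomFun ?AA}" for Xs
    by (rule prod, rule obj) (use that in blast)
  moreover have "FSM_non_uniformly_infinite (disj_unions Xs)"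
    if "set Xs \<subseteq> {as_obj Atom ?A, as_obj AtomFun ?AA, as_obj Subset ?PA}" for Xs
    by (rule FSM_non_uniformly_infinite_disj_unions, rule obj) (use that in blast)
  ultimately show ?thesis
    unfolding Let_def
    by (intro conjI allI impI A PA AA fs_fun pow_fin pow_cofin iter sum
        FSM_non_uniformly_infinite_inj_tuples) auto
qed

end
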